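(* Let $f:\mathbb{N}\to\mathbb{C}$ be a Hecke-multiplicative function. Then for all real $1\le y\le x$, $$\sum_{n\le x/y}|f(n)|^2 \le 10^8\Big(\frac{1+\log y}{\sqrt{y}}\Big)\sum_{n\le x}|f(n)|^2.$$
   Context: A function $f:\mathbb{N}\to\mathbb{C}$ is called Hecke-multiplicative if $f(1)=1$ and for all natural numbers $m,n$, $f(m)f(n)=\sum_{d\mid (m,n)} f(mn/d^2)$. Sums over $n$ are over natural numbers. *)

theory Defs
  imports Complex_Main
begin

(* The natural numbers are the positive integers here; f 0 is unconstrained and never used. *)
definition hecke_multiplicative :: "(nat \<Rightarrow> complex) \<Rightarrow> bool" where
  "hecke_multiplicative f \<longleftrightarrow>
     f 1 = 1 \<and>
     (\<forall>m n. 0 < m \<longrightarrow> 0 < n \<longrightarrow>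
        f m * f n = (\<Sum>d | d dvd gcd m n. f (m * n div d\<^sup>2)))"

end

theory Submission
  imports Defs "HOL-Computational_Algebra.Primes"
begin

text \<open>
  Write \<open>F(z)\<close> for the sum of \<open>|f(n)|\<^sup>2\<close> over \<open>n \<le> z\<close>. We induct downwards on \<open>y\<close> for fixed \<open>x\<close>, so
  that the bound may be used for \<open>F(x/(yd))\<close>, \<open>d \<ge> 2\<close>. By Chebyshev there are \<open>\<gg> R / ln R\<close> primes in
  \<open>[R/5, R]\<close>, \<open>R = \<surd>y\<close>, and at least half of them satisfy either \<open>|f(p)| \<le> 1/2\<close> or \<open>|f(p)| \<ge> 1/2\<close>.

  In the first case \<open>|f(p\<^sup>2)| \<ge> 3/4\<close>, and up to a negligible term \<open>|f(n)|\<close> is at most a constant times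
  \<open>|f(p\<^sup>2 n)|\<close>. Averaging over \<open>p\<close> gains \<open>R / ln R\<close> on those \<open>n \<le> x/y\<close> that are divisible by fewer
  than 130 of the \<open>p\<^sup>2\<close>. In the second case let \<open>S\<close> be the sum of \<open>|f(p)|\<^sup>2\<close>; comparing \<open>f(p) f(q) f(n)\<close>
  with \<open>f(p q n)\<close> gains \<open>(S/j)\<^sup>2\<close> on those \<open>n\<close> that are divisible by fewer than \<open>j\<close> of the \<open>p\<close>, and
  \<open>j\<close> of order \<open>S/\<surd>R\<close> suffices.

  The remaining \<open>n\<close> have at least \<open>j\<close> such divisors. The Hecke relations bound their
  contribution by a sum over products \<open>d\<close> of \<open>j\<close> primes (or squares) of terms \<open>F(x/(yd))\<close>. By the
  induction hypothesis this is an elementary symmetric polynomial of degree \<open>j\<close>, which is small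
  because \<open>j\<close> exceeds 8 times the sum of its arguments.
\<close>

section \<open>Primes in an interval\<close>

lemma prod_primes_dvd:
  fixes n :: nat
  assumes "finite A" and "\<And>p. p \<in> A \<Longrightarrow> prime p" and "\<And>p. p \<in> A \<Longrightarrow> p dvd n"
  shows "\<Prod>A dvd n"
  using assms
proof (induction A rule: finite_induct)
  case (insert p A)
  have "coprime p (\<Prod>A)"
    using insert by (intro prod_coprime_right primes_coprime) auto
  then show ?case
    using insert by (simp add: divides_mult)
qed simp

text \<open>Erdos' argument. An even \<open>n > 2\<close> is not prime, so it adds nothing. For
  \<open>n = 2 * m + 1\<close> the primes above \<open>m + 1\<close> all divide
  \<open>n choose m\<close>, which occurs twice in its row and so is at most \<open>4 ^ m\<close>;
  the induction hypothesis covers the primes up to \<open>m + 1\<close>.\<close>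

lemma prod_primes_le_four_power:
  fixes n :: nat
  shows "(\<Prod>p | prime p \<and> p \<le> n. p) \<le> 4 ^ n"
proof (induction n rule: less_induct)
  case (less n)
  consider "n \<le> 2" | "n > 2" "even n" | "n > 2" "odd n"
    by linarith
  then show ?case
  proof cases
    case 1
    have "{p. prime p \<and> p \<le> n} = (if n = 2 then {2} else {})"
      using 1 by (auto dest: prime_ge_2_nat)
    then show ?thesis by simp
  next
    case 2
    then have "{p. prime p \<and> p \<le> n} = {p. prime p \<and> p \<le> n - 1}"
      by (auto simp: le_less dest: prime_odd_nat)
    moreover have "(\<Prod>p | prime p \<and> p \<le> n - 1. p) \<le> 4 ^ (n - 1)"
      using less[of "n - 1"] 2 by auto
    moreover have "(4::nat) ^ (n - 1) \<le> 4 ^ n" by (intro power_increasing) auto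
    ultimately show ?thesis by (metis order_trans)
  next
    case odd: 3
    from \<open>odd n\<close> obtain m where "n = 2 * m + 1" by (rule oddE)
    with \<open>n > 2\<close> have 3: "n = 2 * m + 1" "m > 0" by auto
    define A where "A = {p. prime p \<and> p \<le> m + 1}"
    define B where "B = {p. prime p \<and> m + 1 < p \<and> p \<le> n}"
    have fin: "finite A" "finite B"
      unfolding A_def B_def by (auto intro: finite_subset[of _ "{..n}"])
    have B_dvd: "\<Prod>B dvd (n choose m)"
    proof -
      have "p dvd n choose m" if "p \<in> B" for p
      proof -
        have p: "prime p" "m + 1 < p" "p \<le> n" using that by (auto simp: B_def)
        have "p dvd fact n" using p by (simp add: prime_dvd_fact_iff)
        moreover have "fact m * fact (n - m) * (n choose m) = fact n"
          using 3 by (intro binomial_fact_lemma) auto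
        moreover have "\<not> p dvd fact m" "\<not> p dvd fact (n - m)"
          using p 3 by (simp_all add: prime_dvd_fact_iff del: fact_Suc)
        ultimately show ?thesis
          using p(1) by (metis prime_dvd_mult_iff)
      qed
      then show ?thesis
        using fin(2) by (intro prod_primes_dvd) (auto simp: B_def)
    qed
    have "2 * (n choose m) \<le> 2 ^ n"
    proof -
      have "n choose m = n choose (m + 1)"
        using 3 binomial_symmetric[of m n] by simp
      then have "2 * (n choose m) = (\<Sum>k\<in>{m, m + 1}. n choose k)" by simp
      also have "\<dots> \<le> (\<Sum>k\<le>n. n choose k)"
        using 3 by (intro sum_mono2) auto
      finally show ?thesis by (simp add: choose_row_sum)
    qed
    then have "(n choose m) \<le> 4 ^ m"
      using 3 by (simp add: power_mult)
    moreover have "\<Prod>B \<le> (n choose m)"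
      using B_dvd 3 by (intro dvd_imp_le) auto
    ultimately have Ble: "\<Prod>B \<le> 4 ^ m" by linarith
    have "{p. prime p \<and> p \<le> n} = A \<union> B"
      using 3 by (auto simp: A_def B_def)
    then have "(\<Prod>p | prime p \<and> p \<le> n. p) = \<Prod>A * \<Prod>B"
      using fin by (simp add: prod.union_disjoint A_def B_def disjoint_iff)
    also have "\<dots> \<le> 4 ^ (m + 1) * 4 ^ m"
      using Ble less[of "m + 1"] 3 unfolding A_def by (intro mult_mono) auto
    also have "\<dots> = 4 ^ n"
      using 3 by (simp flip: power_add)
    finally show ?thesis .
  qed
qed

text \<open>The reciprocals of \<open>k * (n choose k)\<close> form Leibniz' harmonic triangle, so they are
  integer combinations of \<open>1, 1/2, \<dots>, 1/n\<close>.\<close>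
lemma mult_binomial_dvd:
  fixes l :: nat
  assumes "\<And>i. 0 < i \<Longrightarrow> i \<le> n \<Longrightarrow> i dvd l" and "0 < k" and "k \<le> n"
  shows "k * (n choose k) dvd l"
proof -
  have "real l / (real k * real (n choose k)) \<in> \<int>" using assms
  proof (induction k arbitrary: n)
    case 0
    then show ?case by simp
  next
    case (Suc k)
    show ?case
    proof (cases "k = 0")
      case True
      have "n dvd l" using Suc.prems by simp
      then show ?thesis using True by (auto simp: dvd_def)
    next
      case False
      obtain n' where n: "n = Suc n'" using Suc.prems by (cases n) auto
      have k: "k \<le> n'" using Suc.prems n by simp
      define a b where "a = real (n' choose k)" and "b = real (n choose Suc k)"
      have ab: "real k + 1 > 0" "real n > 0" "a > 0"
        using k n by (auto simp: a_def)
      have "Suc k * (n choose Suc k) = n * (n' choose k)"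
        using Suc_times_binomial_eq[of n' k] n by (simp add: mult.commute)
      then have e1: "(real k + 1) * b = real n * a"
        unfolding a_def b_def by (metis of_nat_Suc of_nat_mult add.commute)
      have "(n - k) * (n choose k) = n * (n' choose k)"
        using binomial_absorb_comp[of n k] n by simp
      then have e2: "(real n - real k) * real (n choose k) = real n * a"
        unfolding a_def using k n by (metis Suc_leD Suc_le_mono le_SucI of_nat_diff of_nat_mult)
      have nk: "real n - real k > 0" using k n by simp
      have e3: "real (n choose k) = real n * a / (real n - real k)"
        using e2 nk by (simp add: field_simps)
      have "real l / (real k * a) - real l / (real k * real (n choose k)) = real l / (real n * a)"
        unfolding e3 using ab nk False by (simp add: field_simps)
      also have "\<dots> = real l / (real (Suc k) * b)"
        using e1 by (simp add: add.commute)
      finally have "real l / (real (Suc k) * b)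
          = real l / (real k * a) - real l / (real k * real (n choose k))" by simp
      moreover have "real l / (real k * a) \<in> \<int>"
        unfolding a_def using Suc.prems False k n by (intro Suc.IH) auto
      moreover have "real l / (real k * real (n choose k)) \<in> \<int>"
        using Suc.prems False k n by (intro Suc.IH) auto
      ultimately show ?thesis unfolding b_def by simp
    qed
  qed
  then obtain z where "real l / (real k * real (n choose k)) = of_int z"
    by (auto elim: Ints_cases)
  then have "real l = of_int z * (real k * real (n choose k))"
    using assms by (simp add: field_simps)
  then have "int l = z * int (k * (n choose k))"
    by (metis (mono_tags, lifting) of_int_eq_iff of_int_mult of_int_of_nat_eq of_nat_mult)
  then show ?thesis
    by (metis dvd_triv_right int_dvd_int_iff)
qed

text \<open>A prime power dividing \<open>i\<close> is at most \<open>m\<close>, so its exponent is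
  at most \<open>e p\<close>; hence the product is a common multiple of \<open>1, ..., m\<close>, as
  required for the harmonic triangle argument.\<close>

lemma dvd_prod_prime_powers:
  fixes m :: nat and e :: "nat \<Rightarrow> nat"
  assumes e: "\<And>p. prime p \<Longrightarrow> p \<le> m \<Longrightarrow> m < p ^ Suc (e p)"
    and "0 < i" and "i \<le> m"
  shows "i dvd (\<Prod>p | prime p \<and> p \<le> m. p ^ e p)"
proof -
  have le: "p \<le> m" if "p dvd i" for p
    using dvd_imp_le[OF that] assms by linarith
  have "i = (\<Prod>p\<in>prime_factors i. p ^ multiplicity p i)"
    using assms prime_factorization_nat by simp
  also have "\<dots> dvd (\<Prod>p | prime p \<and> p \<le> m. p ^ e p)"
  proof (rule prod_dvd_prod_subset2)
    show "prime_factors i \<subseteq> {p. prime p \<and> p \<le> m}"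
      using le by (auto simp: in_prime_factors_iff)
    fix p assume "p \<in> prime_factors i"
    then have p: "prime p" "p \<le> m"
      using le by (auto simp: in_prime_factors_iff)
    have "p ^ multiplicity p i \<le> i"
      using assms by (intro dvd_imp_le multiplicity_dvd) auto
    then have "p ^ multiplicity p i < p ^ Suc (e p)"
      using e[OF p] assms by linarith
    then have "multiplicity p i < Suc (e p)"
      using p prime_gt_1_nat by (metis power_less_imp_less_exp)
    then show "p ^ multiplicity p i dvd p ^ e p"
      by (intro le_imp_power_dvd) simp
  qed simp
  finally show ?thesis .
qed

text \<open>The least common multiple of \<open>1, ..., 2 * n\<close> is a multiple of
  \<open>n * (2 * n choose n)\<close>, hence at least \<open>4 ^ n / 2\<close>. Primes up to
  \<open>sqrt (2 * n)\<close> contribute at most \<open>2 * n\<close> each, and the larger primes up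
  to \<open>n div 2\<close> at most \<open>2 ^ n\<close> together by the bound on products of
  primes. The primes above \<open>n div 2\<close>, with at most \<open>2 * n\<close> each, have to
  supply the rest.\<close>

lemma card_primes_upper_range:
  fixes n :: nat
  assumes "2 \<le> n"
  shows "(real n - 1) * ln 2
    \<le> (sqrt (2 * real n) + real (card {p. prime p \<and> n div 2 < p \<and> p \<le> 2 * n})) * ln (2 * real n)"
proof -
  define m where "m = 2 * n"
  \<comment> \<open>With the largest admissible exponents, the product of all \<open>p ^ e p\<close>
    is the least common multiple of \<open>1, ..., m\<close>.\<close>
  define e where "e p = (GREATEST k. p ^ k \<le> m)" for p :: nat
  have e: "p ^ e p \<le> m \<and> m < p ^ Suc (e p)" if "prime p" for p
  proof -
    have b: "\<forall>k. p ^ k \<le> m \<longrightarrow> k \<le> m"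
    proof (intro allI impI)
      fix k assume "p ^ k \<le> m"
      moreover have "k < p ^ k"
        using prime_gt_1_nat[OF that] by (intro power_gt_expt) auto
      ultimately show "k \<le> m" by linarith
    qed
    have "p ^ 0 \<le> m" using assms by (simp add: m_def)
    then have "p ^ e p \<le> m"
      unfolding e_def using b GreatestI_nat[of "\<lambda>k. p ^ k \<le> m" 0 m] by blast
    moreover have "\<not> p ^ Suc (e p) \<le> m"
    proof
      assume "p ^ Suc (e p) \<le> m"
      then have "Suc (e p) \<le> e p"
        unfolding e_def using b Greatest_le_nat[of "\<lambda>k. p ^ k \<le> m" _ m] by blast
      then show False by simp
    qed
    ultimately show ?thesis by simp
  qed
  define A B C where "A = {p. prime p \<and> p\<^sup>2 \<le> m}"
    and "B = {p. prime p \<and> m < p\<^sup>2 \<and> p \<le> n div 2}"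
    and "C = {p. prime p \<and> m < p\<^sup>2 \<and> n div 2 < p \<and> p \<le> m}"
  define D where "D = {p. prime p \<and> n div 2 < p \<and> p \<le> 2 * n}"
  have sub: "A \<subseteq> {..m}" "B \<subseteq> {..m}" "C \<subseteq> {..m}" "D \<subseteq> {..m}"
    unfolding A_def B_def C_def D_def m_def by (auto intro: power2_nat_le_imp_le)
  note fin = this[THEN finite_subset, OF finite_atMost]
  have "{p. prime p \<and> p \<le> m} = A \<union> B \<union> C"
    unfolding A_def B_def C_def m_def by (auto intro: power2_nat_le_imp_le)
  then have split: "(\<Prod>p | prime p \<and> p \<le> m. p ^ e p)
      = (\<Prod>p\<in>A. p ^ e p) * (\<Prod>p\<in>B. p ^ e p) * (\<Prod>p\<in>C. p ^ e p)"
    using fin by (simp add: prod.union_disjoint A_def B_def C_def disjoint_iff)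
  have "(\<Prod>p\<in>A. p ^ e p) \<le> (\<Prod>p\<in>A. m)"
    using e by (intro prod_mono) (auto simp: A_def)
  then have leA: "(\<Prod>p\<in>A. p ^ e p) \<le> m ^ card A" by simp
  have "(\<Prod>p\<in>C. p ^ e p) \<le> (\<Prod>p\<in>C. m)"
    using e by (intro prod_mono) (auto simp: C_def)
  then have leC: "(\<Prod>p\<in>C. p ^ e p) \<le> m ^ card C" by simp
  \<comment> \<open>In \<open>B\<close> the square of \<open>p\<close> exceeds \<open>m\<close>, so
    the exponent is at most 1 and only a product of distinct primes remains.\<close>
  have "(\<Prod>p\<in>B. p ^ e p) \<le> (\<Prod>p\<in>B. p)"
  proof (intro prod_mono conjI)
    fix p assume "p \<in> B"
    then have p: "prime p" "m < p ^ 2" by (auto simp: B_def)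
    have "p ^ e p < p ^ 2" using e[OF p(1)] p(2) by linarith
    then have "e p < 2" using prime_gt_1_nat[OF p(1)] by (metis power_less_imp_less_exp)
    then show "p ^ e p \<le> p"
      using prime_gt_0_nat[OF p(1)] power_increasing[of "e p" 1 p] by simp
  qed simp
  also have "\<dots> \<le> (\<Prod>p | prime p \<and> p \<le> n div 2. p)"
  proof (rule dvd_imp_le[OF prod_dvd_prod_subset])
    show "0 < (\<Prod>p | prime p \<and> p \<le> n div 2. p)"
      by (intro prod_pos) (auto intro: prime_gt_0_nat)
  qed (auto simp: B_def)
  also have "\<dots> \<le> 4 ^ (n div 2)" by (rule prod_primes_le_four_power)
  also have "\<dots> = 2 ^ (2 * (n div 2))" by (simp add: power_mult)
  also have "\<dots> \<le> 2 ^ n" by (intro power_increasing) auto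
  finally have leB: "(\<Prod>p\<in>B. p ^ e p) \<le> 2 ^ n" .
  have "n * (m choose n) dvd (\<Prod>p | prime p \<and> p \<le> m. p ^ e p)"
    using e assms by (intro mult_binomial_dvd dvd_prod_prime_powers) (auto simp: m_def)
  moreover have "(\<Prod>p | prime p \<and> p \<le> m. p ^ e p) > 0"
    by (intro prod_pos) (auto simp: prime_gt_0_nat)
  ultimately have "n * (m choose n) \<le> (\<Prod>p | prime p \<and> p \<le> m. p ^ e p)"
    by (rule dvd_imp_le)
  also have "\<dots> \<le> m ^ card A * 2 ^ n * m ^ card C"
    unfolding split using leA leB leC by (intro mult_mono) auto
  also have "\<dots> \<le> m ^ card A * 2 ^ n * m ^ card D"
    using assms fin by (intro mult_left_mono power_increasing card_mono) (auto simp: C_def D_def m_def)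
  finally have "n * (m choose n) \<le> m ^ card A * 2 ^ n * m ^ card D" .
  then have "real (n * (m choose n)) \<le> real (m ^ card A * 2 ^ n * m ^ card D)"
    by (rule of_nat_mono)
  then have up: "real n * real (m choose n) \<le> real m ^ (card A + card D) * 2 ^ n"
    by (simp add: power_add mult_ac)
  have "4 ^ n / (2 * real n) \<le> real (m choose n)"
    using central_binomial_lower_bound[of n] assms by (simp add: m_def)
  then have "4 ^ n / 2 \<le> real n * real (m choose n)"
    using assms by (simp add: field_simps)
  then have "(4::real) ^ n / 2 \<le> real m ^ (card A + card D) * 2 ^ n" using up by linarith
  moreover have "(4::real) ^ n = 2 ^ n * 2 ^ n" by (simp flip: power_mult_distrib)
  ultimately have "(2::real) ^ n / 2 \<le> real m ^ (card A + card D)" by simp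
  then have "ln ((2::real) ^ n / 2) \<le> ln (real m ^ (card A + card D))"
    using assms by (intro ln_mono) (auto simp: m_def)
  moreover have m0: "0 < real m" using assms by (simp add: m_def)
  ultimately have main: "(real n - 1) * ln 2 \<le> real (card A + card D) * ln (real m)"
    using m0 by (simp add: ln_div ln_realpow algebra_simps)
  have "A \<subseteq> {1..nat \<lfloor>sqrt (real m)\<rfloor>}"
  proof
    fix p assume "p \<in> A"
    then have "real p \<le> sqrt (real m)" "0 < p"
      by (auto simp: A_def prime_gt_0_nat intro!: real_le_rsqrt simp flip: of_nat_power)
    then show "p \<in> {1..nat \<lfloor>sqrt (real m)\<rfloor>}"
      by (simp add: le_nat_floor)
  qed
  then have "card A \<le> nat \<lfloor>sqrt (real m)\<rfloor>"
    using card_mono[of "{1..nat \<lfloor>sqrt (real m)\<rfloor>}" A] by simp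
  then have "real (card A) \<le> sqrt (real m)"
    by (smt (verit) of_nat_floor of_nat_le_iff real_sqrt_ge_zero of_nat_0_le_iff)
  then have "real (card A + card D) * ln (real m) \<le> (sqrt (real m) + real (card D)) * ln (real m)"
    using assms by (intro mult_right_mono) (auto simp: m_def)
  with main show ?thesis unfolding m_def D_def by simp
qed

text \<open>With \<open>n\<close> the integer part of \<open>R / 2\<close>, the primes counted
  before exceed about \<open>R / 4\<close>, hence \<open>R / 5\<close>, and are at most
  \<open>R\<close>. The main term is about \<open>R / 4\<close> because \<open>ln 2\<close> is at
  least \<open>1 / 2\<close>, and \<open>sqrt R * ln R\<close> is small enough to leave
  \<open>R / 8\<close>.\<close>

lemma card_primes_interval_ge:
  fixes R :: real
  assumes "10 ^ 8 \<le> R"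
  shows "R / (8 * ln R) \<le> real (card {p. prime p \<and> R / 5 \<le> real p \<and> real p \<le> R})"
proof -
  have "100000000 \<le> R" using assms by simp
  define n where "n = nat \<lfloor>R / 2\<rfloor>"
  have n: "real n \<le> R / 2" "R / 2 - 1 < real n" "2 \<le> n"
    using \<open>100000000 \<le> R\<close> unfolding n_def by linarith+
  define D where "D = {p. prime p \<and> n div 2 < p \<and> p \<le> 2 * n}"
  define E where "E = {p. prime p \<and> R / 5 \<le> real p \<and> real p \<le> R}"
  have "D \<subseteq> E"
  proof
    fix p assume "p \<in> D"
    then have p: "prime p" "n < 2 * p" "p \<le> 2 * n" by (auto simp: D_def)
    then have "real n < 2 * real p" "real p \<le> 2 * real n" by linarith+
    then show "p \<in> E" using n p(1) assms by (auto simp: E_def)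
  qed
  moreover have "finite E"
    by (rule finite_subset[of _ "{..nat \<lfloor>R\<rfloor>}"]) (auto simp: E_def le_nat_floor)
  ultimately have DE: "real (card D) \<le> real (card E)" by (simp add: card_mono)
  have lnR: "0 < ln R" using assms by simp
  have "(real n - 1) * ln 2 \<le> (sqrt (2 * real n) + real (card D)) * ln (2 * real n)"
    unfolding D_def using n by (intro card_primes_upper_range)
  also have "\<dots> \<le> (sqrt R + real (card E)) * ln R"
    using n DE by (intro mult_mono add_mono) auto
  finally have 1: "(real n - 1) * ln 2 \<le> (sqrt R + real (card E)) * ln R" .
  have ln2: "1 / 2 \<le> ln (2::real)"
    using ln_le_minus_one[of "1 / 2 :: real"] by (simp add: ln_div)
  have "(R / 2 - 2) * (1 / 2) \<le> (real n - 1) * ln 2"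
    using n assms ln2 by (intro mult_mono) auto
  with 1 have 2: "R / 4 - 1 \<le> (sqrt R + real (card E)) * ln R" by simp
  \<comment> \<open>The fourth root makes \<open>ln R \<le> 4 * r\<close> available, so that
    \<open>sqrt R * ln R\<close> is at most \<open>4 * r ^ 3\<close>, which is at most
    \<open>R / 25\<close> since \<open>r \<ge> 100\<close>.\<close>
  define r where "r = sqrt (sqrt R)"
  have r2: "r\<^sup>2 = sqrt R" "r ^ 4 = R"
    using assms by (simp_all add: r_def power4_eq_xxxx mult.assoc)
  have "sqrt (sqrt (10 ^ 8)) \<le> r"
    unfolding r_def using assms by (intro real_sqrt_le_mono)
  moreover have "sqrt (sqrt (10 ^ 8)) = (100::real)"
    by (intro real_sqrt_unique) (auto intro!: real_sqrt_unique)
  ultimately have r: "100 \<le> r" by simp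
  have "ln R = 4 * ln r" using r r2(2) by (metis ln_realpow of_nat_numeral less_le_trans zero_less_numeral)
  also have "\<dots> \<le> 4 * r" using ln_le_minus_one[of r] r by simp
  finally have "sqrt R * ln R \<le> r\<^sup>2 * (4 * r)"
    unfolding r2(1) using assms by (intro mult_left_mono) auto
  also have "\<dots> \<le> R / 25"
    using r unfolding r2(2)[symmetric] by (simp add: power2_eq_square power4_eq_xxxx)
  finally have "R / 8 \<le> real (card E) * ln R"
    using 2 assms by (simp add: algebra_simps)
  then show ?thesis
    unfolding E_def[symmetric] using lnR by (simp add: field_simps)
qed

section \<open>Elementary inequalities\<close>

text \<open>The ratio is an upper bound for \<open>exp 1 / 8\<close>, which arises in the next
  estimate.\<close>

lemma mult_power_three_eighths_le:
  assumes "4 \<le> j"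
  shows "(real j + 1) * (3 / 8) ^ j \<le> 1 / 4"
  using assms
proof (induction j rule: dec_induct)
  case base
  then show ?case by (simp add: power_divide)
next
  case (step j)
  have "(real (Suc j) + 1) * (3 / 8) \<le> real j + 1" by simp
  then have "(real (Suc j) + 1) * (3 / 8) * (3 / 8) ^ j \<le> (real j + 1) * (3 / 8) ^ j"
    by (intro mult_right_mono) auto
  also have "\<dots> \<le> 1 / 4" by (rule step.IH)
  finally show ?case by (simp only: power_Suc mult.assoc)
qed

text \<open>Rankin's trick: scaling each argument by 8 gains \<open>8 ^ j\<close>, while the sum
  over all subsets factors into a product that is at most \<open>exp (8 * sum)\<close>, hence at
  most \<open>3 ^ j\<close>. The factor \<open>real j + 1\<close> makes room for the growth of the
  logarithm when \<open>y\<close> is multiplied by \<open>j\<close> prime powers.\<close>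

lemma elementary_symmetric_sum_le:
  fixes g :: "'a \<Rightarrow> real"
  assumes "finite P" and g: "\<And>p. p \<in> P \<Longrightarrow> 0 \<le> g p"
    and j: "8 * (\<Sum>p\<in>P. g p) \<le> real j" "4 \<le> j"
  shows "(real j + 1) * (\<Sum>A | A \<subseteq> P \<and> card A = j. \<Prod>p\<in>A. g p) \<le> 1 / 4"
proof -
  let ?e = "\<Sum>A | A \<subseteq> P \<and> card A = j. \<Prod>p\<in>A. g p"
  have "8 ^ j * ?e = (\<Sum>A | A \<subseteq> P \<and> card A = j. \<Prod>p\<in>A. 8 * g p)"
    unfolding sum_distrib_left by (intro sum.cong) (auto simp: prod.distrib)
  also have "\<dots> \<le> (\<Sum>A\<in>Pow P. \<Prod>p\<in>A. 8 * g p)"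
    using assms by (intro sum_mono2 prod_nonneg) auto
  also have "\<dots> = (\<Prod>p\<in>P. 8 * g p + 1)"
    using assms(1) by (simp add: prod_add)
  also have "\<dots> \<le> (\<Prod>p\<in>P. exp (8 * g p))"
    using g by (intro prod_mono) (auto simp: add.commute)
  also have "\<dots> = exp (8 * (\<Sum>p\<in>P. g p))"
    using assms(1) by (simp add: exp_sum sum_distrib_left)
  also have "\<dots> \<le> exp (real j)" using j by simp
  also have "\<dots> = exp 1 ^ j" by (simp flip: exp_of_nat_mult)
  also have "\<dots> \<le> 3 ^ j" by (intro power_mono exp_le) auto
  finally have "?e \<le> (3 / 8) ^ j" by (simp add: field_simps power_divide)
  then have "(real j + 1) * ?e \<le> (real j + 1) * (3 / 8) ^ j"
    by (intro mult_left_mono) auto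
  also have "\<dots> \<le> 1 / 4" using j by (intro mult_power_three_eighths_le)
  finally show ?thesis .
qed

lemma cmod_add_power2_le: "(cmod (u + v))\<^sup>2 \<le> 2 * (cmod u)\<^sup>2 + 2 * (cmod v)\<^sup>2"
proof -
  have "(cmod (u + v))\<^sup>2 \<le> (cmod u + cmod v)\<^sup>2"
    by (intro power_mono norm_triangle_ineq) auto
  also have "\<dots> \<le> 2 * (cmod u)\<^sup>2 + 2 * (cmod v)\<^sup>2"
    using sum_squares_bound[of "cmod u" "cmod v"] by (simp add: power2_sum)
  finally show ?thesis .
qed

lemma cmod_diff_power2_le: "(cmod (u - v))\<^sup>2 \<le> 2 * (cmod u)\<^sup>2 + 2 * (cmod v)\<^sup>2"
  using cmod_add_power2_le[of u "- v"] by simp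

lemma cmod_add5_power2_le:
  "(cmod (u1 + u2 + u3 + u4 + u5))\<^sup>2
    \<le> 5 * ((cmod u1)\<^sup>2 + (cmod u2)\<^sup>2 + (cmod u3)\<^sup>2 + (cmod u4)\<^sup>2 + (cmod u5)\<^sup>2)"
proof -
  define a b c d e where "a = cmod u1" "b = cmod u2" "c = cmod u3" "d = cmod u4" "e = cmod u5"
  have "cmod (u1 + u2 + u3 + u4 + u5) \<le> a + b + c + d + e"
    unfolding a_b_c_d_e_def by (intro norm_triangle_le add_mono order_refl)
  then have "(cmod (u1 + u2 + u3 + u4 + u5))\<^sup>2 \<le> (a + b + c + d + e)\<^sup>2"
    by (intro power_mono) auto
  also have "\<dots> \<le> 5 * (a\<^sup>2 + b\<^sup>2 + c\<^sup>2 + d\<^sup>2 + e\<^sup>2)"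
  proof -
    have "0 \<le> (a - b)\<^sup>2 + (a - c)\<^sup>2 + (a - d)\<^sup>2 + (a - e)\<^sup>2 + (b - c)\<^sup>2 + (b - d)\<^sup>2 + (b - e)\<^sup>2
        + (c - d)\<^sup>2 + (c - e)\<^sup>2 + (d - e)\<^sup>2" by simp
    then show ?thesis by (simp add: power2_eq_square algebra_simps)
  qed
  finally show ?thesis unfolding a_b_c_d_e_def .
qed

lemma sum_multiples:
  fixes d Z :: nat and g :: "nat \<Rightarrow> 'a::comm_monoid_add"
  assumes "0 < d"
  shows "(\<Sum>n | n \<in> {1..Z} \<and> d dvd n \<and> Q n. g n) = (\<Sum>m | m \<in> {1..Z div d} \<and> Q (d * m). g (d * m))"
proof (rule sum.reindex_bij_witness[where i = "\<lambda>m. d * m" and j = "\<lambda>n. n div d"])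
  fix n assume "n \<in> {n. n \<in> {1..Z} \<and> d dvd n \<and> Q n}"
  moreover from this obtain k where k: "n = d * k" by auto
  ultimately show "n div d \<in> {m. m \<in> {1..Z div d} \<and> Q (d * m)}"
    using assms by (auto simp: less_eq_div_iff_mult_less_eq mult.commute)
next
  fix m assume "m \<in> {m. m \<in> {1..Z div d} \<and> Q (d * m)}"
  then show "d * m \<in> {n. n \<in> {1..Z} \<and> d dvd n \<and> Q n}"
    using assms by (auto simp: less_eq_div_iff_mult_less_eq mult.commute)
qed (use assms in auto)

section \<open>Hecke relations\<close>

locale hecke =
  fixes f :: "nat \<Rightarrow> complex"
  assumes hecke: "hecke_multiplicative f"
begin

definition a :: "nat \<Rightarrow> real" where "a n = (cmod (f n))\<^sup>2"

definition G :: "(nat \<Rightarrow> bool) \<Rightarrow> nat \<Rightarrow> real" where "G Q Z = (\<Sum>n | n \<in> {1..Z} \<and> Q n. a n)"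

text \<open>The cut-off is a natural number, so that passing from \<open>x / y\<close> to
  \<open>x / (y * d)\<close> becomes the integer division \<open>Z div d\<close>.\<close>

definition F :: "nat \<Rightarrow> real" where "F Z = (\<Sum>n\<in>{1..Z}. a n)"

lemma a_nonneg [simp]: "0 \<le> a n"
  by (simp add: a_def)

lemma G_nonneg [simp]: "0 \<le> G Q Z"
  by (simp add: G_def sum_nonneg)

lemma F_nonneg [simp]: "0 \<le> F Z"
  by (simp add: F_def sum_nonneg)

lemma G_True: "G (\<lambda>n. True) = F"
  by (auto simp: fun_eq_iff G_def F_def intro!: sum.cong)

lemma G_mono: "Z \<le> Z' \<Longrightarrow> G Q Z \<le> G Q Z'"
  unfolding G_def by (intro sum_mono2) auto

lemma F_mono: "Z \<le> Z' \<Longrightarrow> F Z \<le> F Z'"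
  unfolding F_def by (intro sum_mono2) auto

lemma prime_mult:
  assumes "prime p" and "0 < n"
  shows "f p * f n = f (p * n) + (if p dvd n then f (n div p) else 0)"
proof -
  have p: "0 < p" using assms prime_gt_0_nat by blast
  then have e: "f p * f n = (\<Sum>d | d dvd gcd p n. f (p * n div d\<^sup>2))"
    using hecke assms by (auto simp: hecke_multiplicative_def)
  show ?thesis
  proof (cases "p dvd n")
    case True
    then have "{d. d dvd gcd p n} = {1, p}"
      using assms(1) by (auto simp: prime_nat_iff gcd_nat.absorb1)
    moreover have "p \<noteq> 1" using assms(1) by auto
    ultimately show ?thesis
      using True p unfolding e by (simp add: power2_eq_square)
  next
    case False
    then have "gcd p n = 1"
      using assms(1) by (simp add: prime_imp_coprime)
    then show ?thesis using False unfolding e by simp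
  qed
qed

text \<open>The relation for \<open>p\<close> and \<open>n\<close> is multiplied by a further
  \<open>f p\<close>. If \<open>p\<close> divides \<open>n\<close>, expanding
  \<open>f p * f (n div p)\<close> produces one more \<open>f n\<close>; moved to the left it
  becomes the 1 subtracted there.\<close>

lemma prime_square_mult:
  assumes "prime p" and "0 < n"
  shows "(f (p\<^sup>2) - (if p dvd n then 1 else 0)) * f n
    = f (p\<^sup>2 * n) + (if p\<^sup>2 dvd n then f (n div p\<^sup>2) else 0)"
proof -
  have p: "0 < p" using assms prime_gt_0_nat by blast
  have "f 1 = 1" using hecke by (simp add: hecke_multiplicative_def)
  then have 1: "f p * f p = f (p\<^sup>2) + 1"
    using prime_mult[OF assms(1) p] p by (simp add: power2_eq_square)
  have 2: "f p * f (p * n) = f (p\<^sup>2 * n) + f n"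
    using prime_mult[OF assms(1), of "p * n"] p assms by (simp add: power2_eq_square mult.assoc)
  have 3: "f p * f n = f (p * n) + (if p dvd n then f (n div p) else 0)"
    by (rule prime_mult[OF assms])
  have 4: "f (p\<^sup>2) * f n = f p * (f p * f n) - f n"
    using 1 by (simp add: algebra_simps)
  show ?thesis
  proof (cases "p dvd n")
    case True
    then obtain k where k: "n = p * k" by auto
    have k0: "0 < k" using k assms by simp
    have "f p * f (n div p) = f n + (if p\<^sup>2 dvd n then f (n div p\<^sup>2) else 0)"
      using prime_mult[OF assms(1) k0] k p by (simp add: power2_eq_square)
    then have "f p * (f p * f n) = f (p\<^sup>2 * n) + f n + (f n + (if p\<^sup>2 dvd n then f (n div p\<^sup>2) else 0))"
      unfolding 3 using True 2 by (simp add: algebra_simps)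
    then show ?thesis using True 4 by (simp add: algebra_simps)
  next
    case False
    then have "\<not> p\<^sup>2 dvd n" by (auto simp: power2_eq_square dest: dvd_mult_left)
    then show ?thesis using False 4 3 2 by simp
  qed
qed

section \<open>Sums of \<open>a\<close> over multiples of prime powers, and double counting\<close>

lemma a_prime_mult_le:
  assumes "prime p" and "0 < m"
  shows "a (p * m) \<le> 2 * a p * a m + 2 * (if p dvd m then a (m div p) else 0)"
proof -
  have "f (p * m) = f p * f m - (if p dvd m then f (m div p) else 0)"
    using prime_mult[OF assms] by simp
  then show ?thesis
    using cmod_diff_power2_le[of "f p * f m" "if p dvd m then f (m div p) else 0"]
    by (auto simp: a_def norm_mult power_mult_distrib mult.assoc)
qed

text \<open>Invariance of \<open>Q\<close> under \<open>p\<close> lets the terms with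
  \<open>p dvd m\<close> be reindexed into a sum over the same \<open>Q\<close>. Later
  \<open>Q\<close> records divisibility by other primes, so that primes can be split off one at a
  time.\<close>

lemma sum_a_prime_mult_le:
  assumes p: "prime p" and Q: "\<And>m. 0 < m \<Longrightarrow> Q (p * m) = Q m"
  shows "(\<Sum>m | m \<in> {1..U} \<and> Q m. a (p * m)) \<le> (2 * a p + 2) * G Q U"
proof -
  have "(\<Sum>m | m \<in> {1..U} \<and> Q m. a (p * m))
      \<le> (\<Sum>m | m \<in> {1..U} \<and> Q m. 2 * a p * a m + 2 * (if p dvd m then a (m div p) else 0))"
    using p by (intro sum_mono a_prime_mult_le) auto
  also have "\<dots> = 2 * a p * G Q U + 2 * (\<Sum>m | m \<in> {1..U} \<and> Q m. if p dvd m then a (m div p) else 0)"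
    by (simp add: G_def sum.distrib sum_distrib_left)
  also have "(\<Sum>m | m \<in> {1..U} \<and> Q m. if p dvd m then a (m div p) else 0)
      = (\<Sum>m | m \<in> {1..U} \<and> p dvd m \<and> Q m. a (m div p))"
    by (subst sum.inter_filter[symmetric]) (auto intro!: sum.cong)
  also have "\<dots> = (\<Sum>m | m \<in> {1..U div p} \<and> Q (p * m). a (p * m div p))"
    using prime_gt_0_nat[OF p] by (rule sum_multiples)
  also have "\<dots> = G Q (U div p)"
    unfolding G_def using prime_gt_0_nat[OF p] Q by (intro sum.cong) auto
  also have "\<dots> \<le> G Q U" by (intro G_mono) simp
  finally show ?thesis by (simp add: algebra_simps)
qed

text \<open>Two applications of the prime bound: the outer one has the small coefficient
  \<open>2 * a p \<le> 1 / 2\<close>, and altogether the factor is \<open>a p + 3\<close>.\<close>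

lemma sum_a_prime_square_mult_le:
  assumes p: "prime p" "a p \<le> 1 / 4" and Q: "\<And>m. 0 < m \<Longrightarrow> Q (p * m) = Q m"
  shows "(\<Sum>m | m \<in> {1..U} \<and> Q m. a (p\<^sup>2 * m)) \<le> 13 / 4 * G Q U"
proof -
  have p0: "0 < p" using prime_gt_0_nat[OF p(1)] .
  have "(\<Sum>m | m \<in> {1..U} \<and> Q m. a (p\<^sup>2 * m))
      \<le> (\<Sum>m | m \<in> {1..U} \<and> Q m. 1 / 2 * a (p * m) + 2 * a m)"
  proof (intro sum_mono)
    fix m assume "m \<in> {m. m \<in> {1..U} \<and> Q m}"
    then have "0 < p * m" using p0 by auto
    from a_prime_mult_le[OF p(1) this] have "a (p\<^sup>2 * m) \<le> 2 * a p * a (p * m) + 2 * a m"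
      using p0 by (simp add: power2_eq_square mult.assoc)
    also have "2 * a p * a (p * m) \<le> 1 / 2 * a (p * m)"
      using p by (intro mult_right_mono) auto
    finally show "a (p\<^sup>2 * m) \<le> 1 / 2 * a (p * m) + 2 * a m" by simp
  qed
  also have "\<dots> = 1 / 2 * (\<Sum>m | m \<in> {1..U} \<and> Q m. a (p * m)) + 2 * G Q U"
    by (simp add: G_def sum.distrib sum_distrib_left)
  also have "\<dots> \<le> 1 / 2 * ((2 * a p + 2) * G Q U) + 2 * G Q U"
    using sum_a_prime_mult_le[of p Q U] p Q by simp
  also have "\<dots> = (a p + 3) * G Q U" by (simp add: algebra_simps)
  also have "\<dots> \<le> 13 / 4 * G Q U" using p by (intro mult_right_mono) auto
  finally show ?thesis .
qed

text \<open>Induction over \<open>A\<close>: divisibility by powers of the remaining primes is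
  unaffected by factors \<open>p\<close>, so \<open>step\<close> splits off \<open>p ^ e\<close> at
  the cost of \<open>w p\<close>. It serves \<open>e = 1\<close> and \<open>e = 2\<close>
  alike.\<close>

lemma G_divisible_le:
  fixes w :: "nat \<Rightarrow> real" and e :: nat
  assumes "finite A" and prime: "\<And>p. p \<in> A \<Longrightarrow> prime p" and w: "\<And>p. p \<in> A \<Longrightarrow> 0 \<le> w p"
    and step: "\<And>p Q U. p \<in> A \<Longrightarrow> (\<And>m. 0 < m \<Longrightarrow> Q (p * m) = Q m) \<Longrightarrow>
      (\<Sum>m | m \<in> {1..U} \<and> Q m. a (p ^ e * m)) \<le> w p * G Q U"
  shows "G (\<lambda>n. \<forall>p\<in>A. p ^ e dvd n) Z \<le> (\<Prod>p\<in>A. w p) * F (Z div (\<Prod>p\<in>A. p ^ e))"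
  using assms
proof (induction A arbitrary: Z rule: finite_induct)
  case empty
  then show ?case by (simp add: G_True)
next
  case (insert p A)
  let ?Q = "\<lambda>n. \<forall>q\<in>A. q ^ e dvd n"
  have p: "prime p" "0 < p" using insert.prems(1) prime_gt_0_nat by blast+
  have Q: "?Q (p ^ i * m) = ?Q m" for m i
  proof -
    have "q ^ e dvd p ^ i * m \<longleftrightarrow> q ^ e dvd m" if "q \<in> A" for q
    proof -
      have "coprime q p" using insert that by (intro primes_coprime) auto
      then have "coprime (q ^ e) (p ^ i)" by simp
      then show ?thesis by (rule coprime_dvd_mult_right_iff)
    qed
    then show ?thesis by simp
  qed
  have "G (\<lambda>n. \<forall>q\<in>insert p A. q ^ e dvd n) Z = (\<Sum>n | n \<in> {1..Z} \<and> p ^ e dvd n \<and> ?Q n. a n)"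
    by (simp add: G_def)
  also have "\<dots> = (\<Sum>m | m \<in> {1..Z div p ^ e} \<and> ?Q (p ^ e * m). a (p ^ e * m))"
    using p by (intro sum_multiples) simp
  also have "\<dots> = (\<Sum>m | m \<in> {1..Z div p ^ e} \<and> ?Q m. a (p ^ e * m))"
    by (simp only: Q)
  also have "\<dots> \<le> w p * G ?Q (Z div p ^ e)"
    using Q[of 1] by (intro insert.prems(3)) auto
  also have "\<dots> \<le> w p * ((\<Prod>q\<in>A. w q) * F (Z div p ^ e div (\<Prod>q\<in>A. q ^ e)))"
    using insert.prems by (intro mult_left_mono insert.IH) auto
  also have "\<dots> = (\<Prod>q\<in>insert p A. w q) * F (Z div (\<Prod>q\<in>insert p A. q ^ e))"
    using insert by (simp add: div_mult2_eq)
  finally show ?case .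
qed

text \<open>Union bound: a number with at least \<open>j\<close> of the properties has all those of
  some \<open>j\<close>-element set.\<close>

lemma G_card_ge_le:
  assumes "finite P"
  shows "G (\<lambda>n. j \<le> card {p\<in>P. r p n}) Z
    \<le> (\<Sum>A | A \<subseteq> P \<and> card A = j. G (\<lambda>n. \<forall>p\<in>A. r p n) Z)"
proof -
  let ?A = "{A. A \<subseteq> P \<and> card A = j}"
  have fin: "finite ?A" using assms by simp
  have G_if: "G Q Z = (\<Sum>n\<in>{1..Z}. if Q n then a n else 0)" for Q
    unfolding G_def by (subst sum.inter_filter[symmetric]) auto
  have "G (\<lambda>n. j \<le> card {p\<in>P. r p n}) Z
      \<le> (\<Sum>n\<in>{1..Z}. \<Sum>A\<in>?A. if \<forall>p\<in>A. r p n then a n else 0)"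
    unfolding G_if
  proof (intro sum_mono)
    fix n
    show "(if j \<le> card {p\<in>P. r p n} then a n else 0) \<le> (\<Sum>A\<in>?A. if \<forall>p\<in>A. r p n then a n else 0)"
    proof (cases "j \<le> card {p\<in>P. r p n}")
      case True
      then obtain B where B: "B \<subseteq> {p\<in>P. r p n}" "card B = j"
        by (meson obtain_subset_with_card_n)
      then have "B \<in> ?A" by auto
      then have "(if \<forall>p\<in>B. r p n then a n else 0) \<le> (\<Sum>A\<in>?A. if \<forall>p\<in>A. r p n then a n else 0)"
        using fin by (intro member_le_sum) auto
      then show ?thesis using True B by (auto simp: subset_iff split: if_splits)
    qed (auto intro: sum_nonneg)
  qed
  also have "\<dots> = (\<Sum>A\<in>?A. G (\<lambda>n. \<forall>p\<in>A. r p n) Z)"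
    unfolding G_if by (rule sum.swap)
  finally show ?thesis .
qed

text \<open>Double counting: a value \<open>m\<close> arises at most once for each \<open>i\<close>,
  and only if \<open>d i dvd m\<close>; at most \<open>k\<close> indices satisfy this.\<close>

lemma sum_a_mult_le:
  assumes "finite I" and "finite T" and d: "\<And>i. i \<in> I \<Longrightarrow> 0 < d i"
    and X: "\<And>i n. i \<in> I \<Longrightarrow> n \<in> T \<Longrightarrow> d i * n \<in> {1..X}"
    and k: "\<And>i n. i \<in> I \<Longrightarrow> n \<in> T \<Longrightarrow> real (card {l\<in>I. d l dvd d i * n}) \<le> k" and "0 \<le> k"
  shows "(\<Sum>i\<in>I. \<Sum>n\<in>T. a (d i * n)) \<le> k * F X"
proof -
  define W where "W = (\<Union>i\<in>I. (\<lambda>n. d i * n) ` T)"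
  have W: "finite W" "W \<subseteq> {1..X}" using assms X by (auto simp: W_def)
  have finW: "finite {m. m \<in> W \<and> d i dvd m}" for i using W(1) by simp
  have "(\<Sum>i\<in>I. \<Sum>n\<in>T. a (d i * n)) = (\<Sum>i\<in>I. \<Sum>m\<in>(\<lambda>n. d i * n) ` T. a m)"
  proof (rule sum.cong[OF refl])
    fix i assume "i \<in> I"
    then have "inj_on (\<lambda>n. d i * n) T" using d[of i] by (auto intro: inj_onI)
    then show "(\<Sum>n\<in>T. a (d i * n)) = (\<Sum>m\<in>(\<lambda>n. d i * n) ` T. a m)"
      by (simp add: sum.reindex)
  qed
  also have "\<dots> \<le> (\<Sum>i\<in>I. \<Sum>m | m \<in> W \<and> d i dvd m. a m)"
    by (intro sum_mono sum_mono2 finW) (auto simp: W_def)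
  also have "\<dots> = (\<Sum>i\<in>I. \<Sum>m\<in>W. if d i dvd m then a m else 0)"
    using W(1) by (simp add: sum.inter_filter)
  also have "\<dots> = (\<Sum>m\<in>W. \<Sum>i\<in>I. if d i dvd m then a m else 0)"
    by (rule sum.swap)
  also have "\<dots> = (\<Sum>m\<in>W. real (card {i\<in>I. d i dvd m}) * a m)"
    using assms(1) by (simp flip: sum.inter_filter)
  also have "\<dots> \<le> (\<Sum>m\<in>W. k * a m)"
    using k by (intro sum_mono mult_right_mono) (auto simp: W_def)
  also have "\<dots> = k * (\<Sum>m\<in>W. a m)" by (simp add: sum_distrib_left)
  also have "\<dots> \<le> k * F X"
    unfolding F_def using W(2) \<open>0 \<le> k\<close> by (intro mult_left_mono sum_mono2) auto
  finally show ?thesis .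
qed

lemma F_div:
  assumes "0 < d"
  shows "(\<Sum>n\<in>{1..Z}. if d dvd n then a (n div d) else 0) = F (Z div d)"
proof -
  have "(\<Sum>n\<in>{1..Z}. if d dvd n then a (n div d) else 0)
      = (\<Sum>n | n \<in> {1..Z} \<and> d dvd n \<and> True. a (n div d))"
    by (subst sum.inter_filter[symmetric]) auto
  also have "\<dots> = F (Z div d)"
    unfolding F_def using assms by (subst sum_multiples) (auto intro!: sum.cong)
  finally show ?thesis .
qed

lemma F_split: "F Z = (\<Sum>n | n \<in> {1..Z} \<and> c n < j. a n) + G (\<lambda>n. j \<le> c n) Z"
  for c :: "nat \<Rightarrow> nat"
proof -
  have "F Z = (\<Sum>n \<in> {n. n \<in> {1..Z} \<and> c n < j} \<union> {n. n \<in> {1..Z} \<and> j \<le> c n}. a n)"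
    unfolding F_def by (rule sum.cong) auto
  also have "\<dots> = (\<Sum>n | n \<in> {1..Z} \<and> c n < j. a n) + G (\<lambda>n. j \<le> c n) Z"
    unfolding G_def by (rule sum.union_disjoint) auto
  finally show ?thesis .
qed

text \<open>Expanding \<open>f p * (f q * f n)\<close> with the prime relation gives five terms,
  whence the factor 5 from Cauchy-Schwarz.\<close>

lemma a_mult_two_primes_le:
  assumes "prime p" and "prime q" and "0 < n"
  shows "a p * a q * a n \<le> 5 * (a (p * q * n) + (if p dvd n then a q * a (n div p) else 0)
    + (if p * q dvd n then a (n div (p * q)) else 0) + (if p = q then a n else 0)
    + (if q dvd n then a p * a (n div q) else 0))"
proof -
  have pq: "0 < p" "0 < q" using assms prime_gt_0_nat by auto
  define u1 u2 u3 u4 u5 where "u1 = f (p * q * n)"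
    and "u2 = (if p dvd n then f q * f (n div p) else 0)"
    and "u3 = (if p * q dvd n then - f (n div (p * q)) else 0)"
    and "u4 = (if p = q \<and> \<not> p dvd n then f n else 0)"
    and "u5 = (if q dvd n then f p * f (n div q) else 0)"
  note u_defs = u1_def u2_def u3_def u4_def u5_def
  have 1: "f q * f n = f (q * n) + (if q dvd n then f (n div q) else 0)"
    using assms by (intro prime_mult)
  have 2: "f p * f (q * n) = f (p * q * n) + (if p dvd q * n then f (q * n div p) else 0)"
    using prime_mult[of p "q * n"] assms pq by (simp add: mult.assoc)
  \<comment> \<open>If \<open>n = p * k\<close>, then \<open>f (q * k)\<close> is rewritten by the
    relation for \<open>q\<close> and \<open>k\<close>, which yields \<open>u2\<close> and the
    negative \<open>u3\<close>. Otherwise \<open>p\<close> divides \<open>q * n\<close> only on the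
    diagonal \<open>p = q\<close>, which yields \<open>u4\<close>.\<close>
  have 3: "(if p dvd q * n then f (q * n div p) else 0) = u2 + u3 + u4"
  proof (cases "p dvd n")
    case True
    then obtain k where k: "n = p * k" by auto
    then have k0: "0 < k" using assms by simp
    have "q * n div p = q * k" using k pq by simp
    moreover have "n div (p * q) = k div q" using k pq by (simp add: div_mult2_eq)
    moreover have "p * q dvd n \<longleftrightarrow> q dvd k" using k pq by simp
    moreover have "f q * f k = f (q * k) + (if q dvd k then f (k div q) else 0)"
      using assms k0 by (intro prime_mult)
    ultimately show ?thesis using True k pq by (auto simp: u2_def u3_def u4_def)
  next
    case False
    then have "p dvd q * n \<longleftrightarrow> p = q"
      using assms by (metis prime_dvd_mult_iff primes_dvd_imp_eq dvd_refl)
    moreover have "\<not> p * q dvd n" using False by (meson dvd_mult_left)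
    ultimately show ?thesis using False pq by (auto simp: u2_def u3_def u4_def)
  qed
  have "f p * f q * f n = f p * (f q * f n)" by simp
  also have "\<dots> = f p * f (q * n) + u5"
    unfolding 1 by (simp add: u5_def distrib_left)
  finally have eq: "f p * f q * f n = u1 + u2 + u3 + u4 + u5"
    unfolding 2 3 by (simp add: u1_def)
  then have "a p * a q * a n = (cmod (u1 + u2 + u3 + u4 + u5))\<^sup>2"
    by (simp add: a_def norm_mult power_mult_distrib flip: eq)
  also have "\<dots> \<le> 5 * ((cmod u1)\<^sup>2 + (cmod u2)\<^sup>2 + (cmod u3)\<^sup>2 + (cmod u4)\<^sup>2 + (cmod u5)\<^sup>2)"
    by (rule cmod_add5_power2_le)
  also have "\<dots> \<le> 5 * (a (p * q * n) + (if p dvd n then a q * a (n div p) else 0)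
    + (if p * q dvd n then a (n div (p * q)) else 0) + (if p = q then a n else 0)
    + (if q dvd n then a p * a (n div q) else 0))"
    unfolding u_defs a_def by (intro mult_left_mono add_mono) (auto simp: norm_mult power_mult_distrib)
  finally show ?thesis .
qed

end

section \<open>The induction step\<close>

text \<open>Here \<open>R\<close> is the square root of \<open>y\<close>, \<open>X\<close> and
  \<open>Z\<close> will be the integer parts of \<open>x\<close> and \<open>x / y\<close>, and
  \<open>H\<close> will be \<open>10 ^ 8 * F X\<close>. The assumption \<open>fit\<close> keeps the
  products \<open>t * n\<close> in range, and \<open>IH\<close> is the claim for
  \<open>y * D\<close>.\<close>

locale hecke_step = hecke +
  fixes y R H :: real and X Z :: nat
  assumes R_ge: "100000000 \<le> R" and y_eq: "y = R * R"
    and fit: "\<And>t n. real t \<le> y \<Longrightarrow> n \<le> Z \<Longrightarrow> t * n \<le> X"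
    and FX: "10 ^ 8 * F X \<le> H"
    and IH: "\<And>D. 2 \<le> D \<Longrightarrow>
      F (Z div D) \<le> H * ((1 + ln (y * real D)) / sqrt (y * real D))"
begin

text \<open>The bound to be established for \<open>F Z\<close>.\<close>

definition K :: real where "K = H * ((1 + ln y) / R)"

lemma sqrt_y: "sqrt y = R"
  using R_ge by (simp add: y_eq)

lemma y_ge: "1 \<le> y"
  unfolding y_eq using R_ge mult_mono[of 1 R 1 R] by simp

lemma ln_y_nonneg: "0 \<le> ln y"
  using y_ge by simp

lemma ln_y_eq: "ln y = 2 * ln R"
  using R_ge by (simp add: y_eq ln_mult)

lemma H_nonneg: "0 \<le> H"
  using FX F_nonneg[of X] by (auto intro: order_trans[rotated])

lemma K_nonneg: "0 \<le> K"
  using H_nonneg ln_y_nonneg R_ge by (simp add: K_def)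

lemma F_X_le: "F X \<le> R / 10 ^ 8 * K"
proof -
  have "10 ^ 8 * F X \<le> H * 1" using FX by simp
  also have "\<dots> \<le> H * (1 + ln y)"
    using H_nonneg ln_y_nonneg by (intro mult_left_mono) auto
  also have "\<dots> = R * K" using R_ge by (simp add: K_def)
  finally show ?thesis by simp
qed

lemma sqrt_R_ge: "10000 \<le> sqrt R"
  using R_ge by (intro real_le_rsqrt) simp

lemma ln_R_le: "ln R \<le> 2 * sqrt R"
proof -
  have "ln (sqrt R) \<le> sqrt R - 1"
    using R_ge by (intro ln_le_minus_one) simp
  then show ?thesis using R_ge by (simp add: ln_sqrt)
qed

lemma sqrt_prime_ge:
  assumes "R / 5 \<le> real p"
  shows "sqrt R / 3 \<le> sqrt (real p)"
proof -
  have "R / 9 \<le> real p" using assms R_ge by simp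
  then have "sqrt (R / 9) \<le> sqrt (real p)" by simp
  then show ?thesis by (simp add: real_sqrt_divide)
qed

text \<open>An additional prime factor saves \<open>sqrt p\<close>, at least
  \<open>10000 / 3\<close>, and at most doubles the logarithmic factor. This makes the terms with
  \<open>n div p\<close> negligible.\<close>

lemma F_div_prime_le:
  assumes p: "prime p" "R / 5 \<le> real p" "real p \<le> R"
  shows "F (Z div p) \<le> 6 / 10 ^ 4 * K"
proof -
  have p2: "2 \<le> p" using p prime_ge_2_nat by blast
  have sp: "sqrt R / 3 \<le> sqrt (real p)" using p by (intro sqrt_prime_ge)
  have s: "10000 / 3 \<le> sqrt (real p)" using sp sqrt_R_ge by linarith
  have "ln (y * real p) = ln y + ln (real p)"
    using p2 y_ge by (simp add: ln_mult)
  moreover have "ln (real p) \<le> ln R"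
    using p2 p by simp
  ultimately have l: "1 + ln (y * real p) \<le> 2 * (1 + ln y)"
    using ln_y_nonneg ln_y_eq by simp
  have "F (Z div p) \<le> H * ((1 + ln (y * real p)) / sqrt (y * real p))"
    using p2 by (rule IH)
  also have "\<dots> = H * ((1 + ln (y * real p)) / (R * sqrt (real p)))"
    by (simp add: real_sqrt_mult sqrt_y)
  also have "\<dots> \<le> H * ((2 * (1 + ln y)) / (R * (10000 / 3)))"
    using H_nonneg l s R_ge ln_y_nonneg by (intro mult_left_mono frac_le) auto
  also have "\<dots> = 6 / 10 ^ 4 * K" using R_ge by (simp add: K_def field_simps)
  finally show ?thesis .
qed

text \<open>After the union bound, \<open>IH\<close> is applied with \<open>D\<close> the product of
  the \<open>j\<close> prime powers. Up to the factor \<open>real j + 1\<close> from the logarithm,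
  the sum over all sets is the elementary symmetric polynomial of the
  \<open>w p / sqrt p ^ e\<close>.\<close>

lemma G_many_divisors_le:
  fixes w :: "nat \<Rightarrow> real" and e j :: nat
  assumes "finite P" and P: "\<And>p. p \<in> P \<Longrightarrow> prime p" "\<And>p. p \<in> P \<Longrightarrow> real p \<le> R"
    and w: "\<And>p. p \<in> P \<Longrightarrow> 0 \<le> w p" and e: "1 \<le> e" "e \<le> 2"
    and step: "\<And>p Q U. p \<in> P \<Longrightarrow> (\<And>m. 0 < m \<Longrightarrow> Q (p * m) = Q m) \<Longrightarrow>
      (\<Sum>m | m \<in> {1..U} \<and> Q m. a (p ^ e * m)) \<le> w p * G Q U"
    and j: "8 * (\<Sum>p\<in>P. w p / sqrt (real p) ^ e) \<le> real j" "4 \<le> j"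
  shows "G (\<lambda>n. j \<le> card {p\<in>P. p ^ e dvd n}) Z \<le> 1 / 4 * K"
proof -
  let ?g = "\<lambda>p. w p / sqrt (real p) ^ e"
  have "G (\<lambda>n. j \<le> card {p\<in>P. p ^ e dvd n}) Z
      \<le> (\<Sum>A | A \<subseteq> P \<and> card A = j. G (\<lambda>n. \<forall>p\<in>A. p ^ e dvd n) Z)"
    using assms(1) by (rule G_card_ge_le)
  also have "\<dots> \<le> (\<Sum>A | A \<subseteq> P \<and> card A = j. K * ((real j + 1) * (\<Prod>p\<in>A. ?g p)))"
  proof (intro sum_mono)
    fix A assume "A \<in> {A. A \<subseteq> P \<and> card A = j}"
    then have A: "A \<subseteq> P" "card A = j" "finite A" using assms(1) finite_subset by auto
    define D where "D = (\<Prod>p\<in>A. p ^ e)"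
    have pA: "prime p" "real p \<le> R" "0 \<le> w p" if "p \<in> A" for p
      using that A P w by auto
    have pos: "0 < p" if "p \<in> A" for p using pA(1)[OF that] prime_gt_0_nat by blast
    have "D > 0" unfolding D_def using pos by (intro prod_pos) auto
    \<comment> \<open>\<open>IH\<close> demands this; \<open>A\<close> is nonempty because
      \<open>j\<close> is at least 4.\<close>
    have "D \<ge> 2"
    proof -
      obtain p where p: "p \<in> A" using A j by fastforce
      have "p ^ 1 dvd p ^ e" using e by (intro le_imp_power_dvd)
      moreover have "p ^ e dvd D" unfolding D_def using A p by (intro dvd_prodI) auto
      ultimately have "p dvd D" by (metis dvd_trans power_one_right)
      then have "p \<le> D" using \<open>D > 0\<close> by (rule dvd_imp_le)
      then show ?thesis using prime_ge_2_nat[OF pA(1)[OF p]] by linarith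
    qed
    \<comment> \<open>Each factor \<open>p ^ e\<close> is at most \<open>R * R = y\<close>, as
      \<open>e \<le> 2\<close>.\<close>
    have lnD: "ln (real D) \<le> real j * ln y"
    proof -
      have "real D \<le> (\<Prod>p\<in>A. y)"
        unfolding D_def of_nat_prod
      proof (intro prod_mono conjI)
        fix p assume "p \<in> A"
        then have "1 \<le> real p" "real p \<le> R" using pos[of p] pA by auto
        then have "real p ^ e \<le> real p ^ 2" using e by (intro power_increasing) auto
        also have "\<dots> \<le> R ^ 2" using \<open>real p \<le> R\<close> by (intro power_mono) auto
        finally show "real (p ^ e) \<le> y" by (simp add: y_eq power2_eq_square)
      qed simp
      then have "real D \<le> y ^ j" using A by simp
      then have "ln (real D) \<le> ln (y ^ j)" using \<open>D > 0\<close> y_ge by simp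
      then show ?thesis using y_ge by (simp add: ln_realpow)
    qed
    have sqrtD: "sqrt (real D) = (\<Prod>p\<in>A. sqrt (real p) ^ e)"
      unfolding D_def using \<open>finite A\<close>
      by (induction A rule: finite_induct) (simp_all add: real_sqrt_mult real_sqrt_power)
    have sD: "0 < sqrt (real D)" using \<open>D > 0\<close> by simp
    have "1 + ln (y * real D) = 1 + ln y + ln (real D)"
      using \<open>D > 0\<close> y_ge by (simp add: ln_mult)
    also have "\<dots> \<le> (1 + ln y) * (real j + 1)"
      using lnD by (simp add: algebra_simps)
    finally have l: "1 + ln (y * real D) \<le> (1 + ln y) * (real j + 1)" .
    have "F (Z div D) \<le> H * ((1 + ln (y * real D)) / sqrt (y * real D))"
      using \<open>D \<ge> 2\<close> by (rule IH)
    also have "\<dots> = H * ((1 + ln (y * real D)) / (R * sqrt (real D)))"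
      by (simp add: real_sqrt_mult sqrt_y)
    also have "\<dots> \<le> H * ((1 + ln y) * (real j + 1) / (R * sqrt (real D)))"
      using H_nonneg l R_ge by (intro mult_left_mono divide_right_mono) auto
    also have "\<dots> = K * ((real j + 1) / sqrt (real D))" by (simp add: K_def)
    finally have FD: "F (Z div D) \<le> K * ((real j + 1) / sqrt (real D))" .
    have "G (\<lambda>n. \<forall>p\<in>A. p ^ e dvd n) Z \<le> (\<Prod>p\<in>A. w p) * F (Z div D)"
      unfolding D_def using A pA step by (intro G_divisible_le) auto
    also have "\<dots> \<le> (\<Prod>p\<in>A. w p) * (K * ((real j + 1) / sqrt (real D)))"
      using FD pA by (intro mult_left_mono prod_nonneg) auto
    also have "\<dots> = K * ((real j + 1) * (\<Prod>p\<in>A. ?g p))"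
      unfolding sqrtD by (simp add: prod_dividef)
    finally show "G (\<lambda>n. \<forall>p\<in>A. p ^ e dvd n) Z \<le> K * ((real j + 1) * (\<Prod>p\<in>A. ?g p))" .
  qed
  also have "\<dots> = K * ((real j + 1) * (\<Sum>A | A \<subseteq> P \<and> card A = j. \<Prod>p\<in>A. ?g p))"
    by (simp add: sum_distrib_left)
  also have "\<dots> \<le> K * (1 / 4)"
    using assms(1) w j K_nonneg by (intro mult_left_mono elementary_symmetric_sum_le) auto
  finally show ?thesis by simp
qed

text \<open>A quarter of \<open>K\<close> is spent on the \<open>n\<close> divisible by many of the
  squares; averaging over \<open>P\<close> bounds the rest by about \<open>K / 50\<close>.\<close>

lemma F_le_if_small_at_primes:
  fixes P :: "nat set"
  assumes P: "\<And>p. p \<in> P \<Longrightarrow> prime p \<and> R / 5 \<le> real p \<and> real p \<le> R \<and> a p \<le> 1 / 4"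
    and card: "R / (16 * ln R) \<le> real (card P)"
  shows "F Z \<le> K"
proof -
  have sub: "P \<subseteq> {1..nat \<lfloor>R\<rfloor>}"
  proof
    fix p assume "p \<in> P"
    with P[of p] show "p \<in> {1..nat \<lfloor>R\<rfloor>}" using prime_ge_1_nat[of p] by (simp add: le_nat_floor)
  qed
  then have fin: "finite P" by (rule finite_subset) simp
  have "card P \<le> nat \<lfloor>R\<rfloor>" using card_mono[OF _ sub] by simp
  then have card_le: "real (card P) \<le> R" using R_ge by linarith
  have lnR: "0 < ln R" using R_ge by simp
  have "0 < R / (16 * ln R)" using lnR R_ge by simp
  then have card_pos: "0 < real (card P)" using card by linarith
  \<comment> \<open>The threshold 130 is \<open>8 * 65 / 4\<close>: the weights
    \<open>(13 / 4) / p\<close> are at most \<open>65 / (4 * R)\<close> and there are at most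
    \<open>R\<close> of them.\<close>
  define c where "c n = card {p\<in>P. p ^ 2 dvd n}" for n
  define T where "T = {n. n \<in> {1..Z} \<and> c n < 130}"
  define A where "A = (\<Sum>n\<in>T. a n)"
  have "finite T" by (simp add: T_def)
  have tail: "G (\<lambda>n. 130 \<le> c n) Z \<le> 1 / 4 * K"
    unfolding c_def
  proof (rule G_many_divisors_le[where w = "\<lambda>p. 13 / 4"])
    have "(\<Sum>p\<in>P. 13 / 4 / sqrt (real p) ^ 2) \<le> (\<Sum>p\<in>P. 65 / 4 / R)"
    proof (intro sum_mono)
      fix p assume "p \<in> P"
      then have "R / 5 \<le> real p" using P by blast
      then show "13 / 4 / sqrt (real p) ^ 2 \<le> 65 / 4 / R"
        using R_ge by (simp add: field_simps)
    qed
    also have "\<dots> = real (card P) * (65 / 4 / R)" by simp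
    also have "\<dots> \<le> R * (65 / 4 / R)" using card_le R_ge by (intro mult_right_mono) auto
    also have "\<dots> = 65 / 4" using R_ge by simp
    finally show "8 * (\<Sum>p\<in>P. 13 / 4 / sqrt (real p) ^ 2) \<le> real 130" by simp
  qed (use fin P sum_a_prime_square_mult_le in auto)
  have pt: "9 / 16 * a n \<le> 2 * a (p\<^sup>2 * n) + 2 * (if p\<^sup>2 dvd n then a (n div p\<^sup>2) else 0)"
    if "p \<in> P" "n \<in> T" for p n
  proof -
    have p: "prime p" "a p \<le> 1 / 4" and n: "0 < n" using that P by (auto simp: T_def)
    \<comment> \<open>This coefficient equals \<open>f p * f p\<close> minus 1 or 2, so its modulus
      is at least \<open>3 / 4\<close>.\<close>
    define b where "b = f (p\<^sup>2) - (if p dvd n then 1 else 0)"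
    have "f 1 = 1" using hecke by (simp add: hecke_multiplicative_def)
    then have "f (p\<^sup>2) = f p * f p - 1"
      using prime_mult[OF p(1) prime_gt_0_nat[OF p(1)]] prime_gt_0_nat[OF p(1)] by (simp add: power2_eq_square)
    then have b: "b = f p * f p - (if p dvd n then 2 else 1)" by (simp add: b_def)
    have "cmod (f p * f p) \<le> 1 / 4"
      using p(2) by (simp add: norm_mult a_def power2_eq_square)
    moreover have "cmod (if p dvd n then 2 else 1) \<le> cmod (f p * f p) + cmod b"
      unfolding b by (metis norm_triangle_sub norm_minus_commute)
    moreover have "1 \<le> cmod (if p dvd n then 2 else 1)" by simp
    ultimately have "3 / 4 \<le> cmod b" by linarith
    then have "(3 / 4)\<^sup>2 \<le> (cmod b)\<^sup>2" by (intro power_mono) auto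
    then have "9 / 16 * a n \<le> (cmod b)\<^sup>2 * a n"
      by (intro mult_right_mono) (auto simp: power2_eq_square)
    also have "\<dots> = (cmod (b * f n))\<^sup>2" by (simp add: a_def norm_mult power_mult_distrib)
    also have "b * f n = f (p\<^sup>2 * n) + (if p\<^sup>2 dvd n then f (n div p\<^sup>2) else 0)"
      unfolding b_def using p(1) n by (rule prime_square_mult)
    also have "(cmod \<dots>)\<^sup>2 \<le> 2 * a (p\<^sup>2 * n) + 2 * (if p\<^sup>2 dvd n then a (n div p\<^sup>2) else 0)"
      using cmod_add_power2_le[of "f (p\<^sup>2 * n)" "if p\<^sup>2 dvd n then f (n div p\<^sup>2) else 0"]
      by (auto simp: a_def)
    finally show ?thesis .
  qed
  have s1: "(\<Sum>p\<in>P. \<Sum>n\<in>T. a (p\<^sup>2 * n)) \<le> 130 * F X"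
  proof (rule sum_a_mult_le)
    fix p n assume pn: "p \<in> P" "n \<in> T"
    have "real (p\<^sup>2) \<le> R\<^sup>2" using P[OF pn(1)] by (simp add: power_mono)
    then have "p\<^sup>2 * n \<le> X"
      using pn by (intro fit) (auto simp: T_def y_eq power2_eq_square)
    then show "p\<^sup>2 * n \<in> {1..X}"
      using pn P[OF pn(1)] prime_gt_0_nat[of p] by (auto simp: T_def Suc_le_eq)
    \<comment> \<open>Multiplying \<open>n\<close> by the square of \<open>p\<close> creates at most
      one new divisor of the form considered, hence at most \<open>129 + 1\<close> in total.\<close>
    have "{l\<in>P. l\<^sup>2 dvd p\<^sup>2 * n} \<subseteq> insert p {l\<in>P. l\<^sup>2 dvd n}"
    proof
      fix l assume l: "l \<in> {l\<in>P. l\<^sup>2 dvd p\<^sup>2 * n}"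
      show "l \<in> insert p {l\<in>P. l\<^sup>2 dvd n}"
      proof (cases "l = p")
        case False
        then have "coprime l p" using l P pn by (intro primes_coprime) auto
        then have "coprime (l\<^sup>2) (p\<^sup>2)" by simp
        then show ?thesis using l by (simp add: coprime_dvd_mult_right_iff)
      qed simp
    qed
    then have "card {l\<in>P. l\<^sup>2 dvd p\<^sup>2 * n} \<le> card (insert p {l\<in>P. l\<^sup>2 dvd n})"
      using fin by (intro card_mono) auto
    also have "\<dots> \<le> Suc (c n)" unfolding c_def by (rule card_insert_le_m1) auto
    also have "\<dots> \<le> 130" using pn by (simp add: T_def)
    finally show "real (card {l\<in>P. l\<^sup>2 dvd p\<^sup>2 * n}) \<le> 130" by simp
  qed (use fin \<open>finite T\<close> P prime_gt_0_nat in auto)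
  have s2: "(\<Sum>n\<in>T. if p\<^sup>2 dvd n then a (n div p\<^sup>2) else 0) \<le> 6 / 10 ^ 4 * K" if "p \<in> P" for p
  proof -
    have p: "prime p" "0 < p" using P[OF that] prime_gt_0_nat by auto
    have "(\<Sum>n\<in>T. if p\<^sup>2 dvd n then a (n div p\<^sup>2) else 0)
        \<le> (\<Sum>n\<in>{1..Z}. if p\<^sup>2 dvd n then a (n div p\<^sup>2) else 0)"
      by (intro sum_mono2) (auto simp: T_def)
    also have "\<dots> = F (Z div p\<^sup>2)" using p by (intro F_div) simp
    also have "\<dots> \<le> F (Z div p)"
      using p by (intro F_mono div_le_mono2) (auto simp: power2_eq_square)
    also have "\<dots> \<le> 6 / 10 ^ 4 * K" using P[OF that] by (intro F_div_prime_le) auto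
    finally show ?thesis .
  qed
  have "real (card P) * (9 / 16 * A) = (\<Sum>p\<in>P. \<Sum>n\<in>T. 9 / 16 * a n)"
    by (simp add: A_def sum_distrib_left)
  also have "\<dots> \<le> (\<Sum>p\<in>P. \<Sum>n\<in>T. 2 * a (p\<^sup>2 * n) + 2 * (if p\<^sup>2 dvd n then a (n div p\<^sup>2) else 0))"
    by (intro sum_mono pt)
  also have "\<dots> = 2 * (\<Sum>p\<in>P. \<Sum>n\<in>T. a (p\<^sup>2 * n))
      + 2 * (\<Sum>p\<in>P. \<Sum>n\<in>T. if p\<^sup>2 dvd n then a (n div p\<^sup>2) else 0)"
    by (simp only: sum.distrib sum_distrib_left)
  also have "\<dots> \<le> 2 * (130 * F X) + 2 * (\<Sum>p\<in>P. 6 / 10 ^ 4 * K)"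
    using s1 s2 by (intro add_mono mult_left_mono sum_mono) auto
  also have "\<dots> = 260 * F X + real (card P) * (12 / 10 ^ 4 * K)" by simp
  \<comment> \<open>The factor \<open>1 + ln y\<close> in \<open>K\<close> pays for the density of
    the primes here: \<open>8 * (1 + ln y)\<close> is \<open>8 + 16 * ln R\<close>, which dominates
    the \<open>16 * ln R\<close> in the bound on \<open>card P\<close>.\<close>
  also have "260 * F X \<le> real (card P) * (1 / 100 * K)"
  proof -
    have "10 ^ 8 * F X \<le> H" by (rule FX)
    also have "H \<le> real (card P) * (8 * K)"
    proof -
      have "H * R \<le> H * (16 * ln R * real (card P))"
        using card lnR H_nonneg by (intro mult_left_mono) (auto simp: field_simps)
      also have "\<dots> \<le> H * ((8 + 16 * ln R) * real (card P))"
        using H_nonneg by (intro mult_left_mono mult_right_mono) auto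
      also have "\<dots> = R * (real (card P) * (8 * K))"
        using R_ge by (simp add: K_def ln_y_eq field_simps)
      finally show ?thesis using R_ge by (simp add: mult.commute)
    qed
    finally have "12500000 * F X \<le> real (card P) * K" by simp
    then show ?thesis using F_nonneg[of X] by linarith
  qed
  finally have "real (card P) * (9 / 16 * A) \<le> real (card P) * (112 / 10 ^ 4 * K)"
    by (simp add: algebra_simps)
  then have "9 / 16 * A \<le> 112 / 10 ^ 4 * K" using card_pos by (simp only: mult_le_cancel_left_pos)
  moreover have "F Z = A + G (\<lambda>n. 130 \<le> c n) Z" unfolding A_def T_def by (rule F_split)
  ultimately show ?thesis using tail K_nonneg by simp
qed

text \<open>Again a quarter of \<open>K\<close> goes to the tail. For the rest, summing over pairs
  of primes gives an inequality with \<open>A / 2\<close> on the right, which is absorbed.\<close>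

lemma F_le_if_large_at_primes:
  fixes P :: "nat set"
  assumes P: "\<And>p. p \<in> P \<Longrightarrow> prime p \<and> R / 5 \<le> real p \<and> real p \<le> R \<and> 1 / 4 \<le> a p"
    and card: "R / (16 * ln R) \<le> real (card P)"
  shows "F Z \<le> K"
proof -
  have sub: "P \<subseteq> {1..nat \<lfloor>R\<rfloor>}"
  proof
    fix p assume "p \<in> P"
    with P[of p] show "p \<in> {1..nat \<lfloor>R\<rfloor>}" using prime_ge_1_nat[of p] by (simp add: le_nat_floor)
  qed
  then have fin: "finite P" by (rule finite_subset) simp
  define S where "S = (\<Sum>p\<in>P. a p)"
  have "(\<Sum>p\<in>P. 1 / 4) \<le> S" unfolding S_def using P by (intro sum_mono) auto
  then have cardS: "real (card P) \<le> 4 * S" by simp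
  have lnR: "0 < ln R" using R_ge by simp
  \<comment> \<open>This crude lower bound suffices to absorb the additive constants in
    \<open>j\<close> and the diagonal pairs \<open>p = q\<close>.\<close>
  have S_ge: "sqrt R / 128 \<le> S"
  proof -
    have "sqrt R / 32 = R / (16 * (2 * sqrt R))" using R_ge by (simp add: field_simps)
    also have "\<dots> \<le> R / (16 * ln R)"
      using R_ge lnR ln_R_le by (intro divide_left_mono) auto
    finally show ?thesis using card cardS by linarith
  qed
  then have S40: "40 \<le> S" using sqrt_R_ge by linarith
  \<comment> \<open>Since \<open>a p \<ge> 1 / 4\<close>, each weight
    \<open>(2 * a p + 2) / sqrt p\<close> is at most \<open>30 * a p / sqrt R\<close>, and
    \<open>240 = 8 * 30\<close>. The 4 ensures \<open>4 \<le> j\<close>.\<close>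
  define j where "j = nat \<lceil>240 * S / sqrt R\<rceil> + 4"
  have "0 \<le> 240 * S / sqrt R" using S40 R_ge by simp
  then have j: "240 * S / sqrt R \<le> real j" "real j \<le> 240 * S / sqrt R + 5" "4 \<le> j"
    unfolding j_def by linarith+
  define c where "c n = card {p\<in>P. p ^ 1 dvd n}" for n
  define T where "T = {n. n \<in> {1..Z} \<and> c n < j}"
  define A where "A = (\<Sum>n\<in>T. a n)"
  have "finite T" by (simp add: T_def)
  have "0 \<le> A" by (simp add: A_def sum_nonneg)
  have tail: "G (\<lambda>n. j \<le> c n) Z \<le> 1 / 4 * K"
    unfolding c_def
  proof (rule G_many_divisors_le[where w = "\<lambda>p. 2 * a p + 2"])
    have "(\<Sum>p\<in>P. (2 * a p + 2) / sqrt (real p) ^ 1) \<le> (\<Sum>p\<in>P. a p * (30 / sqrt R))"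
    proof (intro sum_mono)
      fix p assume "p \<in> P"
      then have p: "R / 5 \<le> real p" "1 / 4 \<le> a p" using P by auto
      have "(2 * a p + 2) / sqrt (real p) \<le> 10 * a p / (sqrt R / 3)"
        using p sqrt_prime_ge[of p] R_ge by (intro frac_le) auto
      then show "(2 * a p + 2) / sqrt (real p) ^ 1 \<le> a p * (30 / sqrt R)" by (simp add: mult.commute)
    qed
    also have "\<dots> = 30 * S / sqrt R" by (simp add: S_def sum_distrib_right sum_divide_distrib sum_distrib_left mult.commute)
    finally show "8 * (\<Sum>p\<in>P. (2 * a p + 2) / sqrt (real p) ^ 1) \<le> real j" using j by simp
  qed (use fin P sum_a_prime_mult_le j in auto)
  have s1: "(\<Sum>i\<in>P \<times> P. \<Sum>n\<in>T. a (fst i * snd i * n)) \<le> (real j + 1)\<^sup>2 * F X"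
  proof (rule sum_a_mult_le)
    fix i n assume i: "i \<in> P \<times> P" and n: "n \<in> T"
    obtain p q where pq: "i = (p, q)" "p \<in> P" "q \<in> P" using i by auto
    note Ppq = P[OF pq(2)] P[OF pq(3)]
    have "real p * real q \<le> R * R" using Ppq R_ge by (intro mult_mono) auto
    then have "p * q * n \<le> X"
      using n by (intro fit) (auto simp: T_def y_eq)
    then show "fst i * snd i * n \<in> {1..X}"
      using n Ppq prime_gt_0_nat[of p] prime_gt_0_nat[of q] by (auto simp: pq(1) T_def Suc_le_eq)
    define W where "W = {l\<in>P. l dvd p * q * n}"
    have "finite W" using fin by (simp add: W_def)
    \<comment> \<open>A prime of \<open>P\<close> dividing \<open>p * q * n\<close> is
      \<open>p\<close>, \<open>q\<close> or one of the at most \<open>j - 1\<close> dividing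
      \<open>n\<close>. This leaves \<open>j + 1\<close> primes and \<open>(j + 1) ^ 2\<close>
      pairs.\<close>
    have "W \<subseteq> insert p (insert q {l\<in>P. l ^ 1 dvd n})"
    proof
      fix l assume l: "l \<in> W"
      then have "prime l" using P by (simp add: W_def)
      then have "l dvd p \<or> l dvd q \<or> l dvd n"
        using l by (auto simp: W_def prime_dvd_mult_iff)
      moreover have "l dvd p \<longleftrightarrow> l = p" "l dvd q \<longleftrightarrow> l = q"
        using \<open>prime l\<close> Ppq by (auto simp: primes_dvd_imp_eq)
      ultimately show "l \<in> insert p (insert q {l\<in>P. l ^ 1 dvd n})"
        using l by (auto simp: W_def)
    qed
    then have "card W \<le> card (insert p (insert q {l\<in>P. l ^ 1 dvd n}))"
      using fin by (intro card_mono) auto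
    also have "\<dots> \<le> Suc (Suc (c n))"
      unfolding c_def using fin by (simp add: card_insert_if)
    also have "\<dots> \<le> j + 1" using n by (simp add: T_def)
    finally have cW: "real (card W) \<le> real j + 1" by simp
    have "{l \<in> P \<times> P. fst l * snd l dvd fst i * snd i * n} \<subseteq> W \<times> W"
      by (auto simp: W_def pq(1) dest: dvd_mult_left dvd_mult_right)
    then have "card {l \<in> P \<times> P. fst l * snd l dvd fst i * snd i * n} \<le> card (W \<times> W)"
      using \<open>finite W\<close> by (intro card_mono) auto
    then have "real (card {l \<in> P \<times> P. fst l * snd l dvd fst i * snd i * n}) \<le> real (card W * card W)"
      by (simp only: card_cartesian_product of_nat_le_iff)
    also have "\<dots> \<le> (real j + 1)\<^sup>2"
      using cW by (auto simp: power2_eq_square intro: mult_mono)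
    finally show "real (card {l \<in> P \<times> P. fst l * snd l dvd fst i * snd i * n}) \<le> (real j + 1)\<^sup>2" .
  qed (use fin \<open>finite T\<close> P prime_gt_0_nat in auto)
  have s2: "(\<Sum>n\<in>T. if d dvd n then a (n div d) else 0) \<le> 6 / 10 ^ 4 * K"
    if "p \<in> P" "p dvd d" "0 < d" for p d
  proof -
    have p: "prime p" "0 < p" using P[OF that(1)] prime_gt_0_nat by auto
    have "(\<Sum>n\<in>T. if d dvd n then a (n div d) else 0)
        \<le> (\<Sum>n\<in>{1..Z}. if d dvd n then a (n div d) else 0)"
      by (intro sum_mono2) (auto simp: T_def)
    also have "\<dots> = F (Z div d)" using that by (intro F_div) simp
    also have "\<dots> \<le> F (Z div p)"
      using p that by (intro F_mono div_le_mono2 dvd_imp_le) auto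
    also have "\<dots> \<le> 6 / 10 ^ 4 * K" using P[OF that(1)] by (intro F_div_prime_le) auto
    finally show ?thesis .
  qed
  define m where "m = 6 / 10 ^ 4 * K"
  have m0: "0 \<le> m" using K_nonneg by (simp add: m_def)
  have inner: "(\<Sum>n\<in>T. a p * a q * a n) \<le> 5 * ((\<Sum>n\<in>T. a (p * q * n)) + a q * m + m
      + (if p = q then A else 0) + a p * m)" if pq: "p \<in> P" "q \<in> P" for p q
  proof -
    have pr: "prime p" "prime q" "0 < p" "0 < q" using P pq prime_gt_0_nat by auto
    have "(\<Sum>n\<in>T. a p * a q * a n) \<le> (\<Sum>n\<in>T. 5 * (a (p * q * n)
        + a q * (if p dvd n then a (n div p) else 0)
        + (if p * q dvd n then a (n div (p * q)) else 0) + (if p = q then a n else 0)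
        + a p * (if q dvd n then a (n div q) else 0)))"
    proof (intro sum_mono)
      fix n assume "n \<in> T"
      then have "0 < n" by (auto simp: T_def)
      from a_mult_two_primes_le[OF pr(1,2) this]
      show "a p * a q * a n \<le> 5 * (a (p * q * n)
        + a q * (if p dvd n then a (n div p) else 0)
        + (if p * q dvd n then a (n div (p * q)) else 0) + (if p = q then a n else 0)
        + a p * (if q dvd n then a (n div q) else 0))"
        by (simp only: if_distrib[where f = "\<lambda>x. a p * x"] if_distrib[where f = "\<lambda>x. a q * x"] mult_zero_right)
    qed
    also have "\<dots> = 5 * ((\<Sum>n\<in>T. a (p * q * n))
        + a q * (\<Sum>n\<in>T. if p dvd n then a (n div p) else 0)
        + (\<Sum>n\<in>T. if p * q dvd n then a (n div (p * q)) else 0)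
        + (\<Sum>n\<in>T. if p = q then a n else 0)
        + a p * (\<Sum>n\<in>T. if q dvd n then a (n div q) else 0))"
      by (simp only: sum.distrib flip: sum_distrib_left)
    also have "(\<Sum>n\<in>T. if p = q then a n else 0) = (if p = q then A else 0)"
      by (simp add: A_def)
    finally show ?thesis
    proof (rule order_trans, intro mult_left_mono add_mono order_refl)
      show "(\<Sum>n\<in>T. if p dvd n then a (n div p) else 0) \<le> m"
        unfolding m_def using pq pr by (intro s2[of p]) auto
      show "(\<Sum>n\<in>T. if q dvd n then a (n div q) else 0) \<le> m"
        unfolding m_def using pq pr by (intro s2[of q]) auto
      show "(\<Sum>n\<in>T. if p * q dvd n then a (n div (p * q)) else 0) \<le> m"
        unfolding m_def using pq pr by (intro s2[of p]) auto
    qed auto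
  qed
  have "S\<^sup>2 * A = (\<Sum>p\<in>P. \<Sum>q\<in>P. \<Sum>n\<in>T. a p * a q * a n)"
    by (simp add: S_def A_def power2_eq_square flip: sum_distrib_left sum_distrib_right)
  also have "\<dots> \<le> (\<Sum>p\<in>P. \<Sum>q\<in>P. 5 * ((\<Sum>n\<in>T. a (p * q * n)) + a q * m + m
      + (if p = q then A else 0) + a p * m))"
    by (intro sum_mono inner)
  also have "\<dots> = 5 * ((\<Sum>p\<in>P. \<Sum>q\<in>P. \<Sum>n\<in>T. a (p * q * n)) + real (card P) * S * m
      + (real (card P))\<^sup>2 * m + real (card P) * A + real (card P) * S * m)"
    using fin by (simp add: sum.distrib S_def power2_eq_square sum.delta
      flip: sum_distrib_left sum_distrib_right)
  \<comment> \<open>Every \<open>card P\<close> is replaced by \<open>4 * S\<close>, so that all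
    terms are comparable with the square of \<open>S\<close>.\<close>
  also have "\<dots> \<le> 5 * ((real j + 1)\<^sup>2 * F X + 4 * S * S * m + (4 * S)\<^sup>2 * m + 4 * S * A + 4 * S * S * m)"
  proof (intro mult_left_mono add_mono mult_right_mono power_mono cardS)
    show "(\<Sum>p\<in>P. \<Sum>q\<in>P. \<Sum>n\<in>T. a (p * q * n)) \<le> (real j + 1)\<^sup>2 * F X"
      using s1 sum.cartesian_product[of "\<lambda>p q. \<Sum>n\<in>T. a (p * q * n)" P P]
      by (simp add: split_beta)
  qed (use m0 \<open>0 \<le> A\<close> S40 in auto)
  also have "\<dots> = 5 * ((real j + 1)\<^sup>2 * F X) + 120 * m * S\<^sup>2 + 20 * S * A"
    by (simp add: power2_eq_square algebra_simps)
  \<comment> \<open>The diagonal contribution is at most half of the left-hand side because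
    \<open>S \<ge> 40\<close>.\<close>
  also have "20 * S * A \<le> 1 / 2 * S\<^sup>2 * A"
    using S40 \<open>0 \<le> A\<close> by (intro mult_right_mono) (auto simp: power2_eq_square)
  \<comment> \<open>Since \<open>j + 1\<close> is of order \<open>S / sqrt R\<close>, its square
    cancels the \<open>R\<close> lost in \<open>F_X_le\<close>; the constant \<open>10 ^ 8\<close>
    then outweighs \<open>5 * 1008 ^ 2\<close>.\<close>
  also have "5 * ((real j + 1)\<^sup>2 * F X) \<le> 1 / 10 * K * S\<^sup>2"
  proof -
    have "6 \<le> 768 * S / sqrt R" using S_ge R_ge by (simp add: field_simps)
    then have "real j + 1 \<le> 1008 * S / sqrt R" using j(2) by linarith
    then have "(real j + 1)\<^sup>2 \<le> (1008 * S / sqrt R)\<^sup>2" by (intro power_mono) auto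
    also have "\<dots> = 1016064 * S\<^sup>2 / R"
      using R_ge by (simp add: power_divide power_mult_distrib)
    finally have "(real j + 1)\<^sup>2 * F X \<le> (1016064 * S\<^sup>2 / R) * (R / 10 ^ 8 * K)"
      using F_X_le R_ge by (intro mult_mono) auto
    also have "\<dots> = 1016064 / 10 ^ 8 * (K * S\<^sup>2)" using R_ge by simp
    finally show ?thesis
      using mult_nonneg_nonneg[OF K_nonneg zero_le_power2[of S]] by simp
  qed
  finally have "S\<^sup>2 * A \<le> S\<^sup>2 * (1 / 10 * K + 120 * m + 1 / 2 * A)"
    by (simp add: algebra_simps)
  then have "A \<le> 1 / 10 * K + 120 * m + 1 / 2 * A" using S40 by simp
  moreover have "F Z = A + G (\<lambda>n. j \<le> c n) Z" unfolding A_def T_def by (rule F_split)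
  ultimately show ?thesis using tail K_nonneg unfolding m_def by simp
qed

lemma F_Z_le: "F Z \<le> K"
proof -
  define E where "E = {p. prime p \<and> R / 5 \<le> real p \<and> real p \<le> R}"
  define E1 E2 where "E1 = {p\<in>E. a p \<le> 1 / 4}" and "E2 = {p\<in>E. 1 / 4 < a p}"
  have "finite E"
    by (rule finite_subset[of _ "{..nat \<lfloor>R\<rfloor>}"]) (auto simp: E_def le_nat_floor)
  moreover have "E = E1 \<union> E2" "E1 \<inter> E2 = {}" by (auto simp: E1_def E2_def)
  ultimately have "card E = card E1 + card E2"
    by (metis card_Un_disjoint finite_Un)
  moreover have "R / (8 * ln R) \<le> real (card E)"
    unfolding E_def using R_ge by (intro card_primes_interval_ge) simp
  moreover have "R / (16 * ln R) + R / (16 * ln R) = R / (8 * ln R)" by simp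
  ultimately consider "R / (16 * ln R) \<le> real (card E1)" | "R / (16 * ln R) \<le> real (card E2)"
    by linarith
  then show ?thesis
  proof cases
    case 1
    then show ?thesis by (intro F_le_if_small_at_primes[of E1]) (auto simp: E1_def E_def)
  next
    case 2
    then show ?thesis by (intro F_le_if_large_at_primes[of E2]) (auto simp: E2_def E_def)
  qed
qed

end

section \<open>Downward induction on \<open>y\<close> and the final estimate\<close>

context hecke
begin

text \<open>The integer part of \<open>x / y\<close> is the induction measure; while positive, it
  strictly decreases when \<open>y\<close> is multiplied by \<open>D \<ge> 2\<close>. If it
  vanishes, the left side is an empty sum. If \<open>sqrt y \<le> 10 ^ 8\<close>, the factor on the
  right is at least 1 and monotonicity suffices.\<close>

lemma F_floor_le:
  fixes x y :: real
  assumes "0 \<le> x" and "1 \<le> y"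
  shows "F (nat \<lfloor>x / y\<rfloor>) \<le> 10 ^ 8 * F (nat \<lfloor>x\<rfloor>) * ((1 + ln y) / sqrt y)"
  using assms(2)
proof (induction "nat \<lfloor>x / y\<rfloor>" arbitrary: y rule: less_induct)
  case less
  define X Z where "X = nat \<lfloor>x\<rfloor>" and "Z = nat \<lfloor>x / y\<rfloor>"
  show ?case
  proof (cases "10 ^ 8 \<le> sqrt y \<and> 0 < Z")
    case True
    interpret hecke_step f y "sqrt y" "10 ^ 8 * F X" X Z
    proof
      show "100000000 \<le> sqrt y" "y = sqrt y * sqrt y" using True less.prems by auto
    next
      fix t n :: nat assume tn: "real t \<le> y" "n \<le> Z"
      have "real n \<le> x / y" using tn(2) assms(1) less.prems unfolding Z_def
        by (meson le_nat_floor of_nat_floor of_nat_le_iff order_trans divide_nonneg_nonneg zero_le_one)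
      then have "real n * y \<le> x" using less.prems by (simp add: field_simps)
      moreover have "real t * real n \<le> y * real n" using tn(1) by (intro mult_right_mono) auto
      ultimately have "real (t * n) \<le> x" by (simp add: mult.commute)
      then show "t * n \<le> X" unfolding X_def by (rule le_nat_floor)
    next
      fix D :: nat assume D: "2 \<le> D"
      have "nat \<lfloor>x / (y * real D)\<rfloor> = nat (\<lfloor>x / y\<rfloor> div int D)"
        by (metis divide_divide_eq_left floor_divide_real_eq_div of_int_of_nat_eq of_nat_0_le_iff)
      also have "\<dots> = Z div D"
        unfolding Z_def using assms(1) less.prems by (simp add: nat_div_distrib)
      finally have e: "nat \<lfloor>x / (y * real D)\<rfloor> = Z div D" .
      have "Z div D < Z" using D True by simp
      moreover have "1 \<le> y * real D"
        using D less.prems mult_mono[of 1 y 1 "real D"] by simp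
      ultimately show "F (Z div D) \<le> 10 ^ 8 * F X * ((1 + ln (y * real D)) / sqrt (y * real D))"
        using less.hyps[of "y * real D"] unfolding e Z_def X_def by simp
    qed simp
    show ?thesis using F_Z_le unfolding K_def unfolding X_def Z_def .
  next
    case False
    have ln: "0 \<le> ln y" using less.prems by simp
    have s: "1 \<le> sqrt y" using less.prems by simp
    consider "Z = 0" | "sqrt y \<le> 10 ^ 8" using False by linarith
    then show ?thesis
    proof cases
      case 1
      then show ?thesis using ln s by (simp add: Z_def F_def sum_nonneg)
    next
      case 2
      have "x / y \<le> x" using assms(1) less.prems by (simp add: field_simps mult_le_cancel_left1)
      then have "F Z \<le> 1 * F X" unfolding X_def Z_def by (simp add: F_mono nat_mono floor_mono)
      also have "1 \<le> 10 ^ 8 * ((1 + ln y) / sqrt y)"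
      proof -
        have "sqrt y \<le> 100000000" using 2 by simp
        then have "sqrt y \<le> 100000000 + ln y * 100000000" using ln by linarith
        then show ?thesis using s by (simp add: field_simps)
      qed
      finally show ?thesis by (simp add: X_def Z_def mult_ac mult_right_mono)
    qed
  qed
qed

end

theorem theorem3:
  fixes f :: "nat \<Rightarrow> complex" and x y :: real
  assumes "hecke_multiplicative f"
    and "1 \<le> y" and "y \<le> x"
  shows "(\<Sum>n | 0 < n \<and> real n \<le> x / y. (cmod (f n))\<^sup>2)
    \<le> 10 ^ 8 * ((1 + ln y) / sqrt y) * (\<Sum>n | 0 < n \<and> real n \<le> x. (cmod (f n))\<^sup>2)"
proof -
  interpret hecke f by standard (rule assms)
  have "{n. 0 < n \<and> real n \<le> z} = {1..nat \<lfloor>z\<rfloor>}" if "0 \<le> z" for z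
    using that by (auto simp: le_nat_floor le_nat_iff le_floor_iff)
  then have "(\<Sum>n | 0 < n \<and> real n \<le> z. (cmod (f n))\<^sup>2) = F (nat \<lfloor>z\<rfloor>)" if "0 \<le> z" for z
    using that by (simp add: F_def a_def)
  then show ?thesis
    using F_floor_le[of x y] assms by (simp add: mult_ac)
qed

end
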